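(* Let $m$ be an even positive integer, $n=2m$. Let $a\in\mathbb{F}_{11^n}$, $b\in\mathbb{F}_{11}$, and let $t$ be an integer with $\gcd(t,11^m+1)=1$. Then the $11$-ary function $$f_{a,b,t}(x)=\mathrm{Tr}^n_1\!\left(ax^{t(11^m-1)}\right)+bx^{\frac{11^n-1}{2}}$$ on $\mathbb{F}_{11^n}$ is not a regular bent function.
   Context: Here $p=11$. $\mathrm{Tr}^n_1(x)=\sum_{k=0}^{n-1}x^{p^k}$ is the trace from $\mathbb{F}_{p^n}$ to $\mathbb{F}_p$; note $x^{(p^n-1)/2}\in\{0,1,-1\}\subseteq\mathbb{F}_p$, so $f_{a,b,t}$ maps $\mathbb{F}_{p^n}$ to $\mathbb{F}_p$. Let $\zeta=e^{2\pi\sqrt{-1}/p}$ (with $\zeta^c$ for $c\in\mathbb{F}_p$ meaning $\zeta$ to any integer representative). For $f:\mathbb{F}_{p^n}\to\mathbb{F}_p$, the Walsh transform is $W_f(\lambda)=\sum_{x\in\mathbb{F}_{p^n}}\zeta^{f(x)-\mathrm{Tr}^n_1(\lambda x)}$. $f$ is bent if $|W_f(\lambda)|=p^{n/2}$ for all $\lambda\in\mathbb{F}_{p^n}$, and regular bent if for every $\lambda$, $W_f(\lambda)=p^{n/2}\zeta^{f^*(\lambda)}$ for some function $f^*:\mathbb{F}_{p^n}\to\mathbb{F}_p$. *)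

theory Defs
  imports Complex_Main
begin

text \<open>The finite field of order 11^n is modelled by an arbitrary finite field type 'a
  with CARD('a) = 11^n. Its prime field F_11 is the image of of_nat.\<close>

definition trace11 :: "nat \<Rightarrow> 'a::field \<Rightarrow> 'a" where
  "trace11 n x = (\<Sum>k<n. x ^ (11 ^ k))"

definition zeta11 :: complex where
  "zeta11 = cis (2 * pi / 11)"

definition zpow11 :: "'a::field \<Rightarrow> complex" where
  "zpow11 c = zeta11 ^ (LEAST k::nat. of_nat k = c)"

definition walsh11 :: "nat \<Rightarrow> ('a::{field,finite} \<Rightarrow> 'a) \<Rightarrow> 'a \<Rightarrow> complex" where
  "walsh11 n f lam = (\<Sum>x\<in>UNIV. zpow11 (f x - trace11 n (lam * x)))"

definition regular_bent11 :: "nat \<Rightarrow> ('a::{field,finite} \<Rightarrow> 'a) \<Rightarrow> bool" where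
  "regular_bent11 n f \<longleftrightarrow>
     (\<forall>lam. \<exists>c \<in> range (of_nat :: nat \<Rightarrow> 'a).
        walsh11 n f lam = complex_of_real (11 powr (real n / 2)) * zpow11 c)"

definition f_abt :: "nat \<Rightarrow> nat \<Rightarrow> 'a::field \<Rightarrow> 'a \<Rightarrow> int \<Rightarrow> 'a \<Rightarrow> 'a" where
  "f_abt m n a b t x = trace11 n (a * x powi (t * (11 ^ m - 1))) + b * x ^ ((11 ^ n - 1) div 2)"

end

theory Submission
  imports Defs "HOL-Computational_Algebra.Computational_Algebra" "HOL-Number_Theory.Cong"
begin

text \<open>
  Put q = 11^m, let U be the group of (q+1)-st roots of unity and let eta be its quadratic
  character. Since the function depends only on x^(q-1), its Walsh transform at 0 is
  1 + (q-1) S with S the sum of zeta^v(u) over U, where v(u) = Tr(au) + b eta(u). Comparing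
  coefficients in Z[zeta], regularity at 0 already forces S = 1, i.e. v takes the value 0 once
  more than it takes each t = 1, ..., 10.

  As v(-u) = -v(u), the value 0 is taken an even number of times and every other value an odd
  number of times. If b = 0 or eta(a^(q-1)) = 1, the reflection of U in a^(q-1) preserves v, so each
  nonzero value is taken at one of its at most two fixed points, which is absurd.

  Otherwise the reflection preserves Tr(au) and flips eta, and modulo 11 the moments of Tr(au) must
  agree up to degree 9 with those prescribed by 1 / cosh(bs). On the other hand their generating
  function is the product of the Bessel series I_0(2 s sqrt c) over the m conjugates c of the norm
  of a. The coefficient of s^8 in log I_0(2 s) is -11/192, which vanishes modulo 11, whereas the one in
  log cosh s is -17/2520, which does not. Hence b = 0, a contradiction.
\<close>

section \<open>Linear relations between powers of an 11th root of unity\<close>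

text \<open>Eisenstein's criterion for a given factorisation: the constant coefficient of the
  product contains \<open>P\<close> exactly once, so \<open>P\<close> divides the constant
  coefficient of only one factor, and that factor already has the full degree.\<close>

lemma eisenstein_degree:
  fixes f g :: "int poly"
  assumes P: "prime P" and lc: "\<not> P dvd lead_coeff (f * g)"
    and dv: "\<And>i. i < degree (f * g) \<Longrightarrow> P dvd coeff (f * g) i"
    and sq: "\<not> P\<^sup>2 dvd coeff (f * g) 0"
  shows "degree f = 0 \<or> degree g = 0"
proof -
  have main: "degree u = 0"
    if uv: "u * v = f * g" and u0: "\<not> P dvd coeff u 0" and v0: "P dvd coeff v 0" for u v :: "int poly"
  proof -
    have nz: "u * v \<noteq> 0" using lc uv by auto
    have "\<not> P dvd lead_coeff v"
      using lc uv by (metis dvd_mult lead_coeff_mult)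
    \<comment> \<open>At the first index where \<open>v\<close> is not divisible by
      \<open>P\<close>, the convolution modulo \<open>P\<close> reduces to the term with
      \<open>coeff u 0\<close>. Hence the product has degree at most \<open>i\<close>, which leaves
      no degree for \<open>u\<close>.\<close>
    define i where "i = (LEAST i. \<not> P dvd coeff v i)"
    have i: "\<not> P dvd coeff v i" unfolding i_def
      by (rule LeastI[of _ "degree v"]) fact
    have less: "P dvd coeff v j" if "j < i" for j
      using not_less_Least that unfolding i_def by blast
    have "i \<le> degree v" using i by (metis coeff_eq_0 dvd_0_right not_le)
    have "coeff (u * v) i = (\<Sum>j\<le>i. coeff u j * coeff v (i - j))"
      by (simp add: coeff_mult)
    also have "\<dots> = coeff u 0 * coeff v i + (\<Sum>j\<in>{..i}-{0}. coeff u j * coeff v (i - j))"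
      by (subst sum.remove[of _ 0]) auto
    finally have eq: "coeff (u * v) i = \<dots>" .
    have "P dvd (\<Sum>j\<in>{..i}-{0}. coeff u j * coeff v (i - j))"
      by (intro dvd_sum dvd_mult less) auto
    moreover have "\<not> P dvd coeff u 0 * coeff v i"
      using P u0 i by (simp add: prime_dvd_mult_iff)
    ultimately have "\<not> P dvd coeff (u * v) i"
      unfolding eq by (simp add: dvd_add_left_iff)
    then have "degree (u * v) \<le> i" using dv uv not_le by metis
    then show ?thesis using nz \<open>i \<le> degree v\<close> by (simp add: degree_mult_eq)
  qed
  show ?thesis
  proof (cases "degree (f * g) = 0")
    case True
    have "f * g \<noteq> 0" using lc by auto
    then show ?thesis using True by (auto simp: degree_mult_eq)
  next
    case False
    then have "P dvd coeff f 0 * coeff g 0" using dv[of 0] by (simp add: coeff_mult_0)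
    then have "P dvd coeff f 0 \<or> P dvd coeff g 0" using P by (simp add: prime_dvd_mult_iff)
    moreover have "\<not> (P dvd coeff f 0 \<and> P dvd coeff g 0)"
      using sq by (auto simp: coeff_mult_0 power2_eq_square mult_dvd_mono)
    ultimately show ?thesis using main[of f g] main[of g f] by (auto simp: mult.commute)
  qed
qed

section \<open>Integer polynomials at complex points and the minimal polynomial of
  \<open>zeta11 - 1\<close>\<close>

abbreviation ipoly :: "int poly \<Rightarrow> complex \<Rightarrow> complex" where
  "ipoly f z \<equiv> poly (map_poly of_int f) z"

lemma ipoly_add: "ipoly (f + g) z = ipoly f z + ipoly g z"
proof -
  have "map_poly of_int (f + g) = map_poly complex_of_int f + map_poly of_int g"
    by (intro poly_eqI) (simp add: coeff_map_poly)
  then show ?thesis by simp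
qed

lemma ipoly_mult: "ipoly (f * g) z = ipoly f z * ipoly g z"
proof -
  have "map_poly of_int (f * g) = map_poly complex_of_int f * map_poly of_int g"
    by (intro poly_eqI) (simp add: coeff_map_poly coeff_mult)
  then show ?thesis by simp
qed

lemma ipoly_pcompose: "ipoly (pcompose f g) z = ipoly f (ipoly g z)"
  by (induction f) (simp_all add: pcompose_pCons ipoly_add ipoly_mult map_poly_pCons)

lemma ipoly_sum: "ipoly (\<Sum>i\<in>A. f i) z = (\<Sum>i\<in>A. ipoly (f i) z)"
  by (induction A rule: infinite_finite_induct) (simp_all add: ipoly_add)

text \<open>((x + 1)^11 - 1) / x\<close>

definition Phi11 :: "int poly" where
  "Phi11 = [:11, 55, 165, 330, 462, 462, 330, 165, 55, 11, 1:]"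

lemma degree_Phi11: "degree Phi11 = 10"
  by (simp add: Phi11_def)

lemma Phi11_coeff_dvd: "i < 10 \<Longrightarrow> 11 dvd coeff Phi11 i"
  by (auto simp: Phi11_def coeff_pCons eval_nat_numeral split: nat.split)

lemma zeta11_pow: "zeta11 ^ 11 = 1"
  by (simp add: zeta11_def DeMoivre)

lemma zeta11_neq_1: "zeta11 \<noteq> 1"
proof
  assume "zeta11 = 1"
  then have "cos (2 * pi / 11) = 1" by (simp add: zeta11_def complex_eq_iff)
  moreover have "cos (2 * pi / 11) < cos 0"
    by (rule cos_monotone_0_pi) auto
  ultimately show False by simp
qed

lemma Phi11_root: "ipoly Phi11 (zeta11 - 1) = 0"
proof -
  define w where "w = zeta11 - 1"
  have "w * ipoly Phi11 w = (w + 1) ^ 11 - 1"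
    unfolding Phi11_def by (simp add: map_poly_pCons) algebra
  also have "\<dots> = 0" by (simp add: w_def zeta11_pow)
  finally have "w * ipoly Phi11 w = 0" .
  moreover have "w \<noteq> 0" using zeta11_neq_1 by (simp add: w_def)
  ultimately show ?thesis by (simp add: w_def)
qed

text \<open>A nonzero annihilating polynomial \<open>g\<close> of least degree divides
  \<open>Phi11\<close> up to constants. Eisenstein at 11 then makes \<open>g\<close> constant, and a
  nonzero constant has no root.\<close>

lemma no_small_relation:
  assumes "ipoly f (zeta11 - 1) = 0" "degree f < 10"
  shows "f = 0"
proof (rule ccontr)
  assume "f \<noteq> 0"
  define Q where "Q = (\<lambda>g. g \<noteq> 0 \<and> ipoly g (zeta11 - 1) = 0)"
  define g where "g = arg_min degree Q"
  have "Q f" using assms \<open>f \<noteq> 0\<close> by (simp add: Q_def)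
  then have Qg: "Q g" and g_le: "degree g \<le> degree f"
    
    unfolding g_def using arg_min_nat_lemma[of Q f degree] by simp_all
  have g_min: "degree g \<le> degree h" if "Q h" for h
    unfolding g_def using that by (rule arg_min_nat_le)
  have g0: "g \<noteq> 0" using Qg by (simp add: Q_def)
  \<comment> \<open>Over the integers only pseudo-division is available; \<open>c\<close> is the
    power of the leading coefficient of \<open>g\<close> that it introduces.\<close>
  obtain u r where ur: "pseudo_divmod Phi11 g = (u, r)" by fastforce
  define c where "c = lead_coeff g ^ (Suc (degree Phi11) - degree g)"
  have c0: "c \<noteq> 0" using g0 by (simp add: c_def)
  have eq: "smult c Phi11 = g * u + r" and r: "r = 0 \<or> degree r < degree g"
    using pseudo_divmod[OF g0 ur] by (simp_all add: c_def)
  have "r = 0"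
  proof (rule ccontr)
    assume "r \<noteq> 0"
    have "ipoly (smult c Phi11) (zeta11 - 1) = 0"
      using Phi11_root ipoly_mult[of "[:c:]" Phi11] by simp
    then have "ipoly r (zeta11 - 1) = 0"
      unfolding eq using Qg by (simp add: ipoly_add ipoly_mult Q_def)
    then have "degree g \<le> degree r" using g_min \<open>r \<noteq> 0\<close> by (simp add: Q_def)
    then show False using r \<open>r \<noteq> 0\<close> by auto
  qed
  \<comment> \<open>Gauss's lemma: contents multiply and \<open>Phi11\<close> is primitive, so
    \<open>c\<close> can be cancelled against the contents. The result is an integral factorisation
    with \<open>primitive_part g\<close> as a factor.\<close>
  have "smult c Phi11 = smult (content g * content u) (primitive_part g * primitive_part u)"
    using eq \<open>r = 0\<close> content_times_primitive_part[of g] content_times_primitive_part[of u]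
    by (metis add_0_right mult_smult_left mult_smult_right smult_smult)
  moreover have "content (smult c Phi11) = content g * content u"
    using eq \<open>r = 0\<close> by (simp only: content_mult add_0_right)
  moreover have "content Phi11 = 1" by (simp add: Phi11_def content_def)
  ultimately have "c dvd content g * content u" by (metis content_smult dvd_normalize_iff dvd_refl mult.right_neutral normalize_idem)
  then obtain d where d: "content g * content u = c * d" by blast
  have "smult c Phi11 = smult c (primitive_part g * smult d (primitive_part u))"
    using \<open>smult c Phi11 = smult (content g * content u) _\<close> unfolding d by simp
  then obtain v where fac: "Phi11 = primitive_part g * v"
    using c0 by (metis smult_cancel)
  have "degree (primitive_part g) = 0 \<or> degree v = 0"
  proof (rule eisenstein_degree[of 11])
    show "prime (11 :: int)" by simp
    show "\<not> 11 dvd lead_coeff (primitive_part g * v)"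
      unfolding fac[symmetric] by (simp add: Phi11_def)
    show "\<not> 11\<^sup>2 dvd coeff (primitive_part g * v) 0"
      unfolding fac[symmetric] by (simp add: Phi11_def)
    show "11 dvd coeff (primitive_part g * v) i" if "i < degree (primitive_part g * v)" for i
      using that Phi11_coeff_dvd unfolding fac[symmetric] degree_Phi11 by blast
  qed
  moreover have "degree Phi11 = degree (primitive_part g) + degree v"
    using fac by (metis degree_Phi11 degree_mult_eq degree_0 mult_eq_0_iff zero_neq_numeral)
  moreover have "degree (primitive_part g) < 10" using g_le assms(2) by simp
  ultimately have "degree g = 0" using degree_Phi11 by simp
  then obtain k where "g = [:k:]" by (rule degree_eq_zeroE)
  then show False using Qg by (simp add: Q_def map_poly_pCons)
qed

lemma sum_zeta11_powers: "(\<Sum>t<11. zeta11 ^ t) = 0"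
  using geometric_sum[OF zeta11_neq_1, of 11] by (simp add: zeta11_pow)

text \<open>Subtracting \<open>N 10\<close> times the vanishing sum of all powers removes the top
  term. The remaining polynomial has degree at most 9 and, after the substitution X + 1, falls under
  \<open>no_small_relation\<close>.\<close>

lemma zeta11_relation:
  fixes N :: "nat \<Rightarrow> int"
  assumes "(\<Sum>t<11. of_int (N t) * zeta11 ^ t) = 0" and "s < 11"
  shows "N s = N 10"
proof -
  define f where "f = (\<Sum>t<10. monom (N t - N 10) t)"
  have "ipoly f zeta11 = (\<Sum>t<10. of_int (N t - N 10) * zeta11 ^ t)"
    unfolding f_def by (simp add: ipoly_sum map_poly_monom poly_monom)
  also have "\<dots> = (\<Sum>t<Suc 10. of_int (N t - N 10) * zeta11 ^ t)" unfolding sum.lessThan_Suc by simp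
  also have "\<dots> = (\<Sum>t<11. of_int (N t) * zeta11 ^ t) - of_int (N 10) * (\<Sum>t<11. zeta11 ^ t)"
    by (simp add: algebra_simps sum_subtractf sum_distrib_left)
  finally have "ipoly f zeta11 = 0" using assms(1) sum_zeta11_powers by simp
  then have "ipoly (pcompose f [:1, 1:]) (zeta11 - 1) = 0"
    by (simp add: ipoly_pcompose map_poly_pCons)
  moreover have "degree f \<le> 9" unfolding f_def
    by (intro degree_sum_le) (auto intro: order.trans[OF degree_monom_le])
  ultimately have "pcompose f [:1, 1:] = 0" by (intro no_small_relation) (simp_all add: degree_pcompose)
  then have "f = 0" by (rule pcompose_eq_0) simp
  then have "coeff f s = 0" by simp
  then show ?thesis using assms(2) unfolding f_def
    by (cases "s = 10") (auto simp: coeff_sum)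
qed

section \<open>The field and its norm-one group\<close>

lemma card_power_eq_le:
  fixes c :: "'a::idom"
  assumes "n > 0"
  shows "card {x. x ^ n = c} \<le> n"
proof -
  define p where "p = monom 1 n - [:c:]"
  have "coeff p n = 1" using assms by (simp add: p_def coeff_pCons split: nat.split)
  then have p0: "p \<noteq> 0" by auto
  have roots: "{x. x ^ n = c} = {x. poly p x = 0}" by (simp add: p_def poly_monom)
  have "degree p \<le> n" unfolding p_def by (intro degree_diff_le degree_monom_le) simp
  then show ?thesis using card_poly_roots_bound[OF p0] unfolding roots by simp
qed

locale field_11_2m =
  fixes m :: nat and ty :: "'a::{field,finite} itself"
  assumes even_m: "even m" and m_pos: "m > 0"
    and card_field: "card (UNIV :: 'a set) = 11 ^ (2 * m)"
begin

definition q :: nat where "q = 11 ^ m"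

definition U :: "'a set" where "U = {u. u ^ (q + 1) = 1}"

lemma q_ge: "q \<ge> 121"
proof -
  have "m \<ge> 2" using even_m m_pos by (auto elim!: evenE)
  then have "(11::nat) ^ 2 \<le> q" unfolding q_def by (intro power_increasing) auto
  then show ?thesis by simp
qed

text \<open>For even \<open>m\<close>, \<open>q\<close> is a power of 121. Consequently (q+1)/2 is
  odd, which makes \<open>eta\<close> an odd function.\<close>

lemma q_mod_4: "q mod 4 = 1"
proof -
  obtain k where "m = 2 * k" using even_m by blast
  then have "q = 121 ^ k" unfolding q_def by (simp add: power_mult)
  then show ?thesis by (simp add: power_mod[symmetric, of 121])
qed

lemma card_field_q: "card (UNIV :: 'a set) = q * q"
  by (simp add: card_field q_def power_add[symmetric] mult_2)

lemma char_11: "CHAR('a) = 11"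
proof -
  \<comment> \<open>Translation by 1 permutes the field, so the cardinality vanishes as a field
    element.\<close>
  have "(\<Sum>y\<in>UNIV. 1 + y) = (\<Sum>y\<in>(UNIV :: 'a set). y)"
    by (rule sum.reindex_bij_witness[of _ "\<lambda>y. y - 1" "\<lambda>y. 1 + y"]) auto
  then have "(of_nat (card (UNIV :: 'a set)) :: 'a) = 0" by (simp add: sum.distrib)
  then have "(of_nat 11 :: 'a) = 0" unfolding card_field by simp
  then have "CHAR('a) dvd 11" by (simp only: of_nat_eq_0_iff_char_dvd)
  moreover have "prime (11 :: nat)" by simp
  moreover have "CHAR('a) \<noteq> 1" by simp
  ultimately show ?thesis by (metis prime_nat_iff)
qed

lemma of_nat_eq_iff_mod: "(of_nat j :: 'a) = of_nat k \<longleftrightarrow> j mod 11 = k mod 11"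
  by (simp add: of_nat_eq_iff_cong_CHAR char_11 cong_def)

lemma of_nat_eq_0_iff_11: "(of_nat j :: 'a) = 0 \<longleftrightarrow> 11 dvd j"
  by (simp add: of_nat_eq_0_iff_char_dvd char_11)

lemma frob_add: "(x + y :: 'a) ^ 11 = x ^ 11 + y ^ 11"
  by (rule freshmans_dream) (simp_all add: char_11)

lemma frob_sum: "(sum f A :: 'a) ^ 11 = (\<Sum>i\<in>A. f i ^ 11)"
  by (rule freshmans_dream_sum) (simp_all add: char_11)

lemma fermat: "x \<noteq> 0 \<Longrightarrow> (x::'a) ^ (q * q - 1) = 1"
proof -
  assume x: "x \<noteq> 0"
  have "(\<Prod>y\<in>UNIV-{0}. x * y) = (\<Prod>y\<in>UNIV-{0::'a}. y)"
    by (rule prod.reindex_bij_witness[of _ "\<lambda>y. y / x" "\<lambda>y. x * y"]) (use x in auto)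
  then show ?thesis by (simp add: prod.distrib card_field_q)
qed

lemma power_card_eq: "(x::'a) ^ (q * q) = x"
proof (cases "x = 0")
  case False
  have "x ^ (q * q) = x ^ Suc (q * q - 1)" using q_ge by simp
  then show ?thesis using fermat[OF False] by simp
qed (use q_ge in auto)

text \<open>The 11 images of \<open>of_nat\<close> are roots of X^11 - X, which leaves no room for
  further roots.\<close>

lemma prime_fieldI:
  assumes "(y::'a) ^ 11 = y"
  obtains k where "k < 11" "y = of_nat k"
proof -
  define p :: "'a poly" where "p = monom 1 11 - [:0, 1:]"
  have "coeff p 11 = 1" by (simp add: p_def coeff_pCons split: nat.split)
  then have p0: "p \<noteq> 0" by auto
  have "degree p \<le> 11" unfolding p_def by (intro degree_diff_le degree_monom_le) simp
  then have fin: "finite {y. poly p y = 0}" and card: "card {y. poly p y = 0} \<le> 11"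
    using card_poly_roots_bound[OF p0] poly_roots_finite[OF p0] by auto
  have frob: "(of_nat k :: 'a) ^ 11 = of_nat k" for k
    by (induction k) (simp_all add: frob_add)
  have "of_nat ` {..<11} = {y. poly p y = 0}"
  proof (rule card_seteq[OF fin])
    show "of_nat ` {..<11} \<subseteq> {y. poly p y = 0}" by (auto simp: p_def poly_monom frob)
    have "inj_on (of_nat :: nat \<Rightarrow> 'a) {..<11}" by (auto simp: inj_on_def of_nat_eq_iff_mod)
    then show "card {y. poly p y = 0} \<le> card ((of_nat :: nat \<Rightarrow> 'a) ` {..<11})"
      using card by (simp add: card_image)
  qed
  moreover have "y \<in> {y. poly p y = 0}" using assms by (simp add: p_def poly_monom)
  ultimately show ?thesis using that by auto
qed

text \<open>Frobenius permutes the conjugates cyclically; the last one wraps around to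
  \<open>x\<close> by \<open>power_card_eq\<close>.\<close>

lemma trace_power_11: "trace11 (2 * m) (x::'a) ^ 11 = trace11 (2 * m) x"
proof -
  have "trace11 (2 * m) x ^ 11 = (\<Sum>k<2*m. x ^ (11 ^ Suc k))"
    unfolding trace11_def frob_sum by (simp add: power_mult[symmetric] mult.commute)
  also have "x + \<dots> = (\<Sum>k<Suc (2*m). x ^ (11 ^ k))"
    by (subst sum.lessThan_Suc_shift) simp
  also have "\<dots> = trace11 (2 * m) x + x"
    using power_card_eq[of x] by (simp add: trace11_def q_def power_add[symmetric] mult_2)
  finally show ?thesis by simp
qed

lemma trace_minus: "trace11 k (- x::'a) = - trace11 k x"
  by (simp add: trace11_def sum_negf power_minus_odd)

lemma zpow11_of_nat: "zpow11 (of_nat k :: 'a) = zeta11 ^ k"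
proof -
  define j where "j = (LEAST j. (of_nat j :: 'a) = of_nat k)"
  have pow: "zeta11 ^ i = zeta11 ^ (i mod 11)" for i
    by (metis mult_1 mult_div_mod_eq power_add power_mult power_one zeta11_pow)
  have "(of_nat j :: 'a) = of_nat k" unfolding j_def by (rule LeastI) (rule refl)
  then have "zeta11 ^ j = zeta11 ^ k" using of_nat_eq_iff_mod pow by metis
  then show ?thesis by (simp add: zpow11_def j_def)
qed

section \<open>The group \<open>U\<close> as image of the power map x^(q-1), and its character
  sums\<close>

lemma U_nonzero: "u \<in> U \<Longrightarrow> u \<noteq> 0"
  by (auto simp: U_def)

text \<open>The fibres over \<open>U\<close> cover all (q+1)(q-1) nonzero elements, while
  \<open>U\<close> has at most q+1 elements and each fibre at most q-1. Both bounds must therefore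
  be attained.\<close>

lemma U_card_fibres:
  "card U = q + 1"
  "u \<in> U \<Longrightarrow> card {x. x \<noteq> 0 \<and> x ^ (q - 1) = u} = q - 1"
proof -
  have q1: "q - 1 > 0" using q_ge by simp
  have fib: "{x. x \<noteq> 0 \<and> x ^ (q - 1) = u} = {x. x ^ (q - 1) = u}" if "u \<in> U" for u
    using U_nonzero[OF that] q1 by auto
  have le: "card {x. x \<noteq> 0 \<and> x ^ (q - 1) = u} \<le> q - 1" if "u \<in> U" for u
    unfolding fib[OF that] using card_power_eq_le[OF q1] by simp
  have cardU: "card U \<le> q + 1" unfolding U_def by (rule card_power_eq_le) simp
  have qq: "q * q - 1 = (q + 1) * (q - 1)" by (simp add: algebra_simps)
  have "x ^ (q - 1) \<in> U" if "x \<noteq> 0" for x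
    using fermat[OF that] unfolding U_def mem_Collect_eq power_mult[symmetric] qq by (simp only: mult.commute)
  then have "UNIV - {0} = (\<Union>u\<in>U. {x. x \<noteq> 0 \<and> x ^ (q - 1) = u})" by auto
  then have "q * q - 1 = card (\<Union>u\<in>U. {x. x \<noteq> 0 \<and> x ^ (q - 1) = u})"
    using card_field_q by (metis card_Diff_singleton UNIV_I finite_class.finite_UNIV)
  also have "\<dots> = (\<Sum>u\<in>U. card {x. x \<noteq> 0 \<and> x ^ (q - 1) = u})"
    by (rule card_UN_disjoint) auto
  finally have tot: "(\<Sum>u\<in>U. card {x. x \<noteq> 0 \<and> x ^ (q - 1) = u}) = (q + 1) * (q - 1)"
    using qq by simp
  have "(q + 1) * (q - 1) \<le> (\<Sum>u\<in>U. q - 1)" unfolding tot[symmetric] by (intro sum_mono le)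
  then have "(q + 1) * (q - 1) \<le> card U * (q - 1)" by simp
  then have "q + 1 \<le> card U" using q1 by (meson mult_le_cancel2)
  then show cU: "card U = q + 1" using cardU by simp
  assume u: "u \<in> U"
  show "card {x. x \<noteq> 0 \<and> x ^ (q - 1) = u} = q - 1"
  proof (rule ccontr)
    assume "\<not> ?thesis"
    then have "card {x. x \<noteq> 0 \<and> x ^ (q - 1) = u} < q - 1" using le[OF u] by simp
    then have "(\<Sum>u\<in>U. card {x. x \<noteq> 0 \<and> x ^ (q - 1) = u}) < (\<Sum>u\<in>U. q - 1)"
      using u le by (intro sum_strict_mono_ex1) auto
    then show False using tot cU by simp
  qed
qed

lemma sum_over_U:
  fixes g :: "'a \<Rightarrow> complex"
  shows "(\<Sum>x\<in>UNIV - {0}. g (x ^ (q - 1))) = of_nat (q - 1) * (\<Sum>u\<in>U. g u)"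
proof -
  have qq: "q * q - 1 = (q - 1) * (q + 1)" by (simp add: algebra_simps)
  have U: "x ^ (q - 1) \<in> U" if "x \<noteq> 0" for x
    using fermat[OF that] unfolding U_def mem_Collect_eq power_mult[symmetric] qq .
  have "(\<Sum>x\<in>UNIV - {0}. g (x ^ (q - 1))) =
      (\<Sum>u\<in>U. \<Sum>x\<in>{x\<in>UNIV - {0}. x ^ (q - 1) = u}. g (x ^ (q - 1)))"
    by (rule sum.group[symmetric]) (use U in auto)
  also have "\<dots> = (\<Sum>u\<in>U. of_nat (q - 1) * g u)"
    proof (rule sum.cong)
    fix u assume "u \<in> U"
    moreover have "{x \<in> UNIV - {0}. x ^ (q - 1) = u} = {x. x \<noteq> 0 \<and> x ^ (q - 1) = u}" by auto
    ultimately show "(\<Sum>x\<in>{x \<in> UNIV - {0}. x ^ (q - 1) = u}. g (x ^ (q - 1))) = of_nat (q - 1) * g u"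
      using U_card_fibres(2)[of u] by simp
  qed simp
  finally show ?thesis by (simp add: sum_distrib_left)
qed

lemma U_mult: "u \<in> U \<Longrightarrow> v \<in> U \<Longrightarrow> u * v \<in> U"
  by (simp add: U_def power_mult_distrib del: power_Suc)

lemma U_inverse: "u \<in> U \<Longrightarrow> inverse u \<in> U"
  by (simp add: U_def power_inverse del: power_Suc)

lemma U_powi: "u \<in> U \<Longrightarrow> u powi k \<in> U"
proof -
  assume u: "u \<in> U"
  have pow: "v ^ k \<in> U" if "v \<in> U" for v k
    using that unfolding U_def mem_Collect_eq by (metis power_mult mult.commute power_one)
  show "u powi k \<in> U" using pow[OF u] pow[OF U_inverse[OF u]] by (simp add: power_int_def)
qed

lemma U_minus: "u \<in> U \<Longrightarrow> - u \<in> U"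
proof -
  have "even (q + 1)" using q_mod_4 by presburger
  then show "u \<in> U \<Longrightarrow> - u \<in> U" unfolding U_def mem_Collect_eq by (simp only: power_minus_even)
qed

text \<open>Orthogonality: the order q+1 of \<open>U\<close> is 1 modulo 11. For 0 < |h| < q+1 some
  \<open>w\<close> in \<open>U\<close> has \<open>w powi h\<close> different from 1, and translation
  by \<open>w\<close> multiplies the sum by that factor.\<close>

lemma sum_U_powi:
  assumes "\<bar>h\<bar> \<le> int q"
  shows "(\<Sum>u\<in>U. (u::'a) powi h) = (if h = 0 then 1 else 0)"
proof (cases "h = 0")
  case True
  have "(of_nat (q + 1) :: 'a) = of_nat 1"
    unfolding of_nat_eq_iff_mod q_def using m_pos by (cases m) simp_all
  then show ?thesis using True U_card_fibres(1) by simp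
next
  case False
  have "\<exists>w\<in>U. w ^ nat \<bar>h\<bar> \<noteq> 1"
  proof (rule ccontr)
    assume "\<not> ?thesis"
    then have "U \<subseteq> {u. u ^ nat \<bar>h\<bar> = 1}" by auto
    then have "card U \<le> card {u::'a. u ^ nat \<bar>h\<bar> = 1}" by (rule card_mono[rotated]) simp
    also have "\<dots> \<le> nat \<bar>h\<bar>" using False by (intro card_power_eq_le) simp
    finally show False using assms U_card_fibres(1) by simp
  qed
  then obtain w where w: "w \<in> U" "w ^ nat \<bar>h\<bar> \<noteq> 1" by blast
  have "w powi h \<noteq> 1" using w(2) by (cases "h \<ge> 0") (auto simp: power_int_def power_inverse)
  have "(\<Sum>u\<in>U. u powi h) = (\<Sum>u\<in>U. (w * u) powi h)"
    by (rule sum.reindex_bij_witness[of _ "\<lambda>u. w * u" "\<lambda>u. inverse w * u"])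
       (use w(1) U_nonzero[OF w(1)] in \<open>auto simp: U_mult U_inverse mult.assoc[symmetric]\<close>)
  also have "\<dots> = w powi h * (\<Sum>u\<in>U. u powi h)"
    by (simp add: power_int_mult_distrib sum_distrib_left)
  finally have "(1 - w powi h) * (\<Sum>u\<in>U. u powi h) = 0" by (simp add: algebra_simps)
  then show ?thesis using False \<open>w powi h \<noteq> 1\<close> by simp
qed

section \<open>The Walsh transform at zero\<close>

definition eta :: "'a \<Rightarrow> 'a" where "eta u = u ^ ((q + 1) div 2)"

text \<open>The function in terms of u = x^(q-1), with the exponent \<open>t\<close> removed by a
  permutation of \<open>U\<close>. The power x^((q*q-1)/2) equals \<open>eta u\<close>.\<close>

definition val :: "'a \<Rightarrow> 'a \<Rightarrow> 'a \<Rightarrow> 'a" where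
  "val a b u = trace11 (2 * m) (a * u) + b * eta u"

definition cnt :: "'a \<Rightarrow> 'a \<Rightarrow> nat \<Rightarrow> nat" where
  "cnt a b t = card {u \<in> U. val a b u = of_nat t}"

lemma half_q: "(q + 1) div 2 * 2 = q + 1" "odd ((q + 1) div 2)"
  using q_mod_4 by presburger+

lemma eta_cases: "u \<in> U \<Longrightarrow> eta u = 1 \<or> eta u = - 1"
proof -
  assume "u \<in> U"
  then have "eta u ^ 2 = 1"
    unfolding eta_def power_mult[symmetric] half_q(1) by (simp only: U_def mem_Collect_eq)
  then show ?thesis by (simp add: power2_eq_1_iff)
qed

lemma eta_minus: "eta (- u) = - eta u"
  unfolding eta_def using half_q(2) by (rule power_minus_odd)

lemma eta_mult: "eta (u * v) = eta u * eta v"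
  by (simp add: eta_def power_mult_distrib)

lemma eta_inverse: "eta (inverse u) = inverse (eta u)"
  by (simp add: eta_def power_inverse)

lemma eta_powi_odd:
  assumes "u \<in> U" "odd t"
  shows "eta (u powi t) = eta u"
proof -
  have "eta (u powi t) = eta u powi t"
    by (simp add: eta_def power_int_def power_inverse power_mult[symmetric] mult.commute)
  also have "\<dots> = eta u"
    using eta_cases[OF assms(1)] assms(2) by (auto simp: power_int_minus_left)
  finally show ?thesis .
qed

lemma val_minus: "val a b (- u) = - val a b u"
  by (simp add: val_def eta_minus trace_minus)

lemma val_prime_field:
  assumes "b \<in> range (of_nat :: nat \<Rightarrow> 'a)" "u \<in> U"
  obtains t where "t < 11" "val a b u = of_nat t"
proof (rule prime_fieldI)
  have frob: "(of_nat k :: 'a) ^ 11 = of_nat k" for k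
    by (induction k) (simp_all add: frob_add)
  have "eta u ^ 11 = eta u" using eta_cases[OF assms(2)] by auto
  moreover have "b ^ 11 = b" using assms(1) frob by auto
  ultimately show "val a b u ^ 11 = val a b u"
    by (simp add: val_def frob_add trace_power_11 power_mult_distrib)
qed

lemma sum_val_by_cnt:
  fixes g :: "'a \<Rightarrow> 'b::comm_semiring_1"
  assumes "b \<in> range (of_nat :: nat \<Rightarrow> 'a)"
  shows "(\<Sum>u\<in>U. g (val a b u)) = (\<Sum>t<11. of_nat (cnt a b t) * g (of_nat t))"
proof -
  let ?P = "(of_nat :: nat \<Rightarrow> 'a) ` {..<11}"
  have inj: "inj_on (of_nat :: nat \<Rightarrow> 'a) {..<11}" by (auto simp: inj_on_def of_nat_eq_iff_mod)
  have "val a b ` U \<subseteq> ?P"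
  proof
    fix y assume "y \<in> val a b ` U"
    then obtain u where "u \<in> U" "y = val a b u" by blast
    then show "y \<in> ?P" by (metis val_prime_field[OF assms] imageI lessThan_iff)
  qed
  then have "(\<Sum>u\<in>U. g (val a b u)) = (\<Sum>y\<in>?P. \<Sum>u\<in>{u \<in> U. val a b u = y}. g (val a b u))"
    by (intro sum.group[symmetric]) auto
  also have "\<dots> = (\<Sum>t<11. \<Sum>u\<in>{u \<in> U. val a b u = of_nat t}. g (val a b u))"
    by (simp add: sum.reindex[OF inj])
  also have "\<dots> = (\<Sum>t<11. of_nat (cnt a b t) * g (of_nat t))"
    by (simp add: cnt_def)
  finally show ?thesis .
qed

text \<open>Bezout supplies an exponent \<open>r\<close> inverse to \<open>t\<close> modulo
  q+1.\<close>

lemma powi_bij_U: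
  assumes "gcd t (int (q + 1)) = 1"
  shows "bij_betw (\<lambda>u. u powi t) U U"
proof -
  obtain r s where rs: "r * t + s * int (q + 1) = 1" using assms bezout_int by metis
  have "(u powi t) powi r = u" if u: "u \<in> U" for u
  proof -
    have "(u powi t) powi r = u powi (1 - int (q + 1) * s)"
    proof -
      have "r * t = 1 - int (q + 1) * s" using rs by (simp add: algebra_simps)
      then show ?thesis by (metis power_int_mult mult.commute)
    qed
    also have "\<dots> = u / u powi (int (q + 1) * s)"
      using U_nonzero[OF u] by (subst power_int_diff) auto
    also have "u powi (int (q + 1) * s) = (u ^ (q + 1)) powi s"
      by (metis power_int_mult power_int_of_nat)
    also have "u ^ (q + 1) = 1" using u unfolding U_def by blast
    finally have "(u powi t) powi r = u / 1 powi s" .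
    then show ?thesis by simp
  qed
  then have "inj_on (\<lambda>u. u powi t) U" by (rule inj_on_inverseI)
  moreover have "(\<lambda>u. u powi t) ` U \<subseteq> U" using U_powi by auto
  ultimately show ?thesis
    by (simp add: bij_betw_def endo_inj_surj)
qed

lemma walsh_0:
  assumes "gcd t (11 ^ m + 1) = 1"
  shows "walsh11 (2 * m) (f_abt m (2 * m) a b t) 0 = 1 + of_nat (q - 1) * (\<Sum>u\<in>U. zpow11 (val a b u))"
proof -
  let ?f = "f_abt m (2 * m) a b t"
  have gcd_t: "gcd t (int (q + 1)) = 1" using assms by (simp add: q_def add.commute)
  have "even (int (q + 1))" using q_mod_4 by presburger
  then have "odd t" using gcd_t by (metis gcd_greatest odd_one)
  have q_int: "int (q - 1) = 11 ^ m - 1" by (simp add: q_def of_nat_diff)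
  have "(11 ^ (2 * m) :: nat) = q * q" by (simp add: q_def mult_2 power_add)
  then have "(11 ^ (2 * m) - 1 :: nat) = (q - 1) * (q + 1)" by (simp add: algebra_simps)
  also have "\<dots> = 2 * ((q - 1) * ((q + 1) div 2))"
    using half_q(1) by (metis mult.assoc mult.commute)
  finally have exp2: "(11 ^ (2 * m) - 1 :: nat) div 2 = (q - 1) * ((q + 1) div 2)" by simp
  \<comment> \<open>A zero exponent would give 0 the power 1, so both exponents must be nonzero for
    the function to vanish at 0.\<close>
  have "t * (11 ^ m - 1) \<noteq> 0"
    using q_ge \<open>odd t\<close> unfolding q_int[symmetric] by auto
  moreover have "(q - 1) * ((q + 1) div 2) \<noteq> 0" using q_ge by simp
  ultimately have f0: "?f 0 = 0"
    unfolding f_abt_def exp2 by (simp add: trace11_def power_0_left)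
  have fx: "?f x = val a b ((x ^ (q - 1)) powi t)" if "x \<noteq> 0" for x
  proof -
    have "x ^ (q - 1) \<in> U"
      using fermat[OF that] unfolding U_def mem_Collect_eq power_mult[symmetric]
      by (simp add: algebra_simps)
    then have "eta ((x ^ (q - 1)) powi t) = x ^ ((q - 1) * ((q + 1) div 2))"
      using eta_powi_odd[OF _ \<open>odd t\<close>] by (simp add: eta_def power_mult)
    moreover have "(x ^ (q - 1)) powi t = x powi (t * (11 ^ m - 1))"
      unfolding q_int[symmetric] by (metis power_int_mult power_int_of_nat mult.commute)
    ultimately show ?thesis unfolding f_abt_def val_def exp2 by simp
  qed
  have "walsh11 (2 * m) ?f 0 = (\<Sum>x\<in>UNIV. zpow11 (?f x))"
    by (simp add: walsh11_def trace11_def power_0_left)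
  also have "\<dots> = zpow11 (?f 0) + (\<Sum>x\<in>UNIV - {0}. zpow11 (?f x))"
    by (rule sum.remove) auto
  also have "zpow11 (?f 0) = 1" using zpow11_of_nat[of 0] f0 by simp
  also have "(\<Sum>x\<in>UNIV - {0}. zpow11 (?f x)) =
      (\<Sum>x\<in>UNIV - {0}. zpow11 (val a b ((x ^ (q - 1)) powi t)))"
    by (rule sum.cong) (simp_all add: fx)
  also have "\<dots> = of_nat (q - 1) * (\<Sum>u\<in>U. zpow11 (val a b (u powi t)))"
    by (rule sum_over_U)
  also have "(\<Sum>u\<in>U. zpow11 (val a b (u powi t))) = (\<Sum>u\<in>U. zpow11 (val a b u))"
    using powi_bij_U[OF gcd_t] by (rule sum.reindex_bij_betw)
  finally show ?thesis .
qed

text \<open>Comparing coefficients of powers of \<open>zeta11\<close> leaves two cases. If the dual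
  value \<open>c\<close> is nonzero, q-1 would divide 1; if it is zero, dividing by q-1 gives the
  claim.\<close>

lemma regular_bent_cnt:
  assumes "regular_bent11 (2 * m) (f_abt m (2 * m) a b t)"
    and b: "b \<in> range (of_nat :: nat \<Rightarrow> 'a)" and t: "gcd t (11 ^ m + 1) = 1"
    and s: "0 < s" "s < 11"
  shows "cnt a b 0 = cnt a b s + 1"
proof -
  have "(11::real) powr (real (2 * m) / 2) = real q" by (simp add: powr_realpow q_def)
  then obtain k where "walsh11 (2 * m) (f_abt m (2 * m) a b t) 0 = of_nat q * zpow11 (of_nat k :: 'a)"
    using assms(1) unfolding regular_bent11_def by (metis imageE of_real_of_nat_eq)
  moreover have "(of_nat k :: 'a) = of_nat (k mod 11)" by (simp add: of_nat_eq_iff_mod)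
  moreover define c where "c = k mod 11"
  ultimately have W: "1 + of_nat (q - 1) * (\<Sum>t<11. of_nat (cnt a b t) * zeta11 ^ t) = of_nat q * zeta11 ^ c"
    using sum_val_by_cnt[OF b, of "zpow11"] walsh_0[OF t] by (simp add: zpow11_of_nat)
  have c: "c < 11" by (simp add: c_def)
  \<comment> \<open>Coefficients of left side minus right side of \<open>W\<close>, collected by
    powers of \<open>zeta11\<close>.\<close>
  define N where "N = (\<lambda>t. int (q - 1) * int (cnt a b t) + (if t = 0 then 1 else 0) - (if t = c then int q else 0))"
  have "(\<Sum>t<11. of_int (N t) * zeta11 ^ t) =
      of_nat (q - 1) * (\<Sum>t<11. of_nat (cnt a b t) * zeta11 ^ t)
      + (\<Sum>t<11. if t = 0 then zeta11 ^ t else 0) - (\<Sum>t<11. if t = c then of_nat q * zeta11 ^ t else 0)"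
    unfolding sum_distrib_left sum.distrib[symmetric] sum_subtractf[symmetric]
    by (rule sum.cong) (auto simp: N_def algebra_simps)
  also have "\<dots> = 0" using W c by (simp add: sum.delta algebra_simps)
  finally have "N t = N 10" if "t < 11" for t using zeta11_relation that by blast
  then have N: "N t = N t'" if "t < 11" "t' < 11" for t t' using that by metis
  have "c = 0"
  proof (rule ccontr)
    assume "c \<noteq> 0"
    \<comment> \<open>An index other than 0 and \<open>c\<close>, where \<open>N\<close> has no
      correction term.\<close>
    define t :: nat where "t = (if c = 1 then 2 else 1)"
    have "t < 11" "t \<noteq> 0" "t \<noteq> c" by (auto simp: t_def)
    then have "int (q - 1) * int (cnt a b t) = int (q - 1) * int (cnt a b c) - int q"
      using N[of t c] c \<open>c \<noteq> 0\<close> by (simp add: N_def)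
    then have "int (q - 1) * (int (cnt a b c) - int (cnt a b t) - 1) = 1"
      using q_ge by (simp add: algebra_simps of_nat_diff)
    then have "int (q - 1) dvd 1" by (metis dvd_triv_left)
    then show False using q_ge by simp
  qed
  then have "int (q - 1) * int (cnt a b 0) + 1 - int q = int (q - 1) * int (cnt a b s)"
    using N[of 0 s] s by (simp add: N_def del: of_nat_diff)
  moreover have "int q = int (q - 1) + 1" using q_ge by (simp add: of_nat_diff)
  ultimately have "int (q - 1) * int (cnt a b 0) = int (q - 1) * (int (cnt a b s) + 1)"
    by algebra
  then have "int (cnt a b 0) = int (cnt a b s) + 1" using q_ge by simp
  then show ?thesis by simp
qed

end

section \<open>Parity of the value distribution\<close>

lemma even_card_involution:
  assumes "finite S" "\<And>x. x \<in> S \<Longrightarrow> f x \<in> S" "\<And>x. x \<in> S \<Longrightarrow> f (f x) = x"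
    and "\<And>x. x \<in> S \<Longrightarrow> f x \<noteq> x"
  shows "even (card S)"
  using assms
proof (induction S rule: finite_psubset_induct)
  case (psubset S)
  show ?case
  proof (cases "S = {}")
    case False
    then obtain x where x: "x \<in> S" by blast
    have "even (card (S - {x, f x}))"
      by (rule psubset.IH) (use x psubset.prems in \<open>auto, metis+\<close>)
    moreover have "card {x, f x} = 2" using psubset.prems(3)[OF x] by (metis card_2_iff)
    then have "card (S - {x, f x}) = card S - 2" "card S \<ge> 2"
      using x psubset.prems(1) psubset.hyps card_mono[of S "{x, f x}"]
      by (auto simp: card_Diff_subset)
    ultimately show ?thesis by simp
  qed simp
qed

context field_11_2m begin

lemma eleven_eq_0: "(11 :: 'a) = 0"
  using of_nat_eq_0_iff_11[of 11] by simp

lemma two_neq_0: "(2 :: 'a) \<noteq> 0"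
  using of_nat_eq_0_iff_11[of 2] by simp

lemma even_cnt_0: "even (cnt a b 0)"
  unfolding cnt_def
proof (rule even_card_involution)
  fix u assume "u \<in> {u \<in> U. val a b u = of_nat 0}"
  then show "- u \<in> {u \<in> U. val a b u = of_nat 0}" "- (- u) = u" "- u \<noteq> u"
    using U_nonzero[of u] two_neq_0 by (auto simp: U_minus val_minus equation_minus_iff minus_equation_iff)
qed simp

lemma trace_power_q: "trace11 (2 * m) ((y::'a) ^ q) = trace11 (2 * m) y"
proof -
  have step: "trace11 (2 * m) (y ^ 11) = trace11 (2 * m) y" for y :: 'a
  proof -
    have "trace11 (2 * m) (y ^ 11) = trace11 (2 * m) y ^ 11"
      unfolding trace11_def frob_sum by (simp add: power_mult[symmetric] mult.commute)
    then show ?thesis by (simp add: trace_power_11)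
  qed
  have "trace11 (2 * m) (y ^ (11 ^ k)) = trace11 (2 * m) y" for k
    by (induction k) (simp_all add: power_mult step mult.commute[of 11])
  then show ?thesis by (simp add: q_def)
qed

lemma U_power_q: "u \<in> U \<Longrightarrow> u ^ q = inverse u"
  using U_nonzero[of u] by (auto simp: U_def field_simps)

text \<open>The reflection u \<mapsto> a^(q-1)/u of U corresponds to the conjugation au \<mapsto> (au)^q.\<close>

lemma power_q1_U: "a \<noteq> 0 \<Longrightarrow> a ^ (q - 1) \<in> U"
  using fermat[of a] unfolding U_def mem_Collect_eq power_mult[symmetric] by (simp add: algebra_simps)

lemma reflect_U: "a \<noteq> 0 \<Longrightarrow> u \<in> U \<Longrightarrow> a ^ (q - 1) / u \<in> U"
  unfolding divide_inverse by (intro U_mult U_inverse power_q1_U)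

lemma reflect_trace:
  assumes "a \<noteq> 0" "u \<in> U"
  shows "trace11 (2 * m) (a * (a ^ (q - 1) / u)) = trace11 (2 * m) (a * u)"
proof -
  have "a * a ^ (q - 1) = a ^ q" using q_ge by (cases q) simp_all
  then have "a * (a ^ (q - 1) / u) = (a * u) ^ q"
    using U_power_q[OF assms(2)] by (simp add: power_mult_distrib divide_inverse)
  then show ?thesis by (simp add: trace_power_q)
qed

lemma reflect_eta: "u \<in> U \<Longrightarrow> eta (a ^ (q - 1) / u) = eta (a ^ (q - 1)) * eta u"
  using eta_cases[of u] by (auto simp: divide_inverse eta_mult eta_inverse)

lemma odd_cnt:
  assumes "cnt a b 0 = cnt a b t + 1"
  shows "odd (cnt a b t)"
  using even_cnt_0[of a b] assms by simp

lemma of_nat_distinct: "(1::'a) \<noteq> 2" "(1::'a) \<noteq> 3" "(2::'a) \<noteq> 3"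
  using of_nat_eq_iff_mod[of 1 2] of_nat_eq_iff_mod[of 1 3] of_nat_eq_iff_mod[of 2 3] by simp_all

text \<open>Each nonzero value is taken an odd number of times, hence at some fixed point of the
  reflection. Fixed points are square roots of \<open>a ^ (q - 1)\<close>, too few for the three
  values 1, 2, 3.\<close>

lemma no_symmetric_val:
  assumes cnt: "\<And>t. 0 < t \<Longrightarrow> t < 11 \<Longrightarrow> cnt a b 0 = cnt a b t + 1"
    and a: "a \<noteq> 0" and sym: "b = 0 \<or> eta (a ^ (q - 1)) = 1"
  shows False
proof -
  let ?r = "\<lambda>u. a ^ (q - 1) / u"
  have val: "val a b (?r u) = val a b u" if "u \<in> U" for u
    using sym reflect_trace[OF a that] reflect_eta[OF that, of a] by (auto simp: val_def)
  have fixpt: "\<exists>u. u ^ 2 = a ^ (q - 1) \<and> val a b u = of_nat t" if t: "0 < t" "t < 11" for t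
  proof (rule ccontr)
    assume "\<not> ?thesis"
    then have no: "u ^ 2 \<noteq> a ^ (q - 1)" if "val a b u = of_nat t" for u using that by blast
    have "even (cnt a b t)"
      unfolding cnt_def
    proof (rule even_card_involution[where f = ?r])
      fix u assume u: "u \<in> {u \<in> U. val a b u = of_nat t}"
      then show "?r u \<in> {u \<in> U. val a b u = of_nat t}" using val reflect_U[OF a] by auto
      show "?r (?r u) = u" using a by simp
      show "?r u \<noteq> u" using u no[of u] U_nonzero[of u] by (auto simp: field_simps power2_eq_square)
    qed simp
    then show False using odd_cnt[OF cnt[OF t]] by simp
  qed
  obtain u1 where u1: "u1 ^ 2 = a ^ (q - 1)" "val a b u1 = 1" using fixpt[of 1] by auto
  obtain u2 where u2: "u2 ^ 2 = a ^ (q - 1)" "val a b u2 = 2" using fixpt[of 2] by auto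
  obtain u3 where u3: "u3 ^ 2 = a ^ (q - 1)" "val a b u3 = 3" using fixpt[of 3] by auto
  have "u1 \<noteq> u2" "u1 \<noteq> u3" "u2 \<noteq> u3" using u1 u2 u3 of_nat_distinct by auto
  then have "card {u1, u2, u3} = 3" by simp
  moreover have "card {u1, u2, u3} \<le> card {u. u ^ 2 = a ^ (q - 1)}"
    using u1 u2 u3 by (intro card_mono) auto
  moreover have "card {u. u ^ 2 = a ^ (q - 1)} \<le> 2" by (rule card_power_eq_le) simp
  ultimately show False by simp
qed

text \<open>For \<open>a = 0\<close> only the values \<open>b\<close> and \<open>- b\<close> occur,
  whereas odd counts require all ten nonzero values.\<close>

lemma no_zero_a:
  assumes cnt: "\<And>t. 0 < t \<Longrightarrow> t < 11 \<Longrightarrow> cnt 0 b 0 = cnt 0 b t + 1"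
  shows False
proof -
  have "\<exists>u\<in>U. val 0 b u = of_nat t" if t: "0 < t" "t < 11" for t
  proof (rule ccontr)
    assume "\<not> ?thesis"
    then have "cnt 0 b t = 0" by (simp add: cnt_def)
    then show False using odd_cnt[OF cnt[OF t]] by simp
  qed
  moreover have "val 0 b u = b \<or> val 0 b u = - b" if "u \<in> U" for u
    using eta_cases[OF that] by (auto simp: val_def trace11_def power_0_left)
  ultimately have *: "of_nat t = b \<or> of_nat t = - b" if "0 < t" "t < 11" for t
    using that by metis
  show False using *[of 1] *[of 2] *[of 3] of_nat_distinct by auto
qed

text \<open>The excess count at the value 0 contributes nothing since \<open>k > 0\<close>. The
  other counts agree, so the moment is a multiple of a power sum that vanishes modulo 11.\<close>

lemma val_moment_0:
  assumes cnt: "\<And>t. 0 < t \<Longrightarrow> t < 11 \<Longrightarrow> cnt a b 0 = cnt a b t + 1"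
    and b: "b \<in> range (of_nat :: nat \<Rightarrow> 'a)" and k: "k > 0" "11 dvd (\<Sum>t<11::nat. t ^ k)"
  shows "(\<Sum>u\<in>U. val a b u ^ k) = 0"
proof -
  have "(\<Sum>u\<in>U. val a b u ^ k) = (\<Sum>t<11. of_nat (cnt a b t) * of_nat t ^ k)"
    by (rule sum_val_by_cnt[OF b])
  also have "\<dots> = (\<Sum>t<11. of_nat (cnt a b 1) * of_nat (t ^ k))"
  proof (rule sum.cong)
    fix t :: nat assume "t \<in> {..<11}"
    then show "of_nat (cnt a b t) * of_nat t ^ k = (of_nat (cnt a b 1) * of_nat (t ^ k) :: 'a)"
      using cnt[of t] cnt[of 1] k(1) by (cases "t = 0") auto
  qed simp
  also have "\<dots> = of_nat (cnt a b 1) * of_nat (\<Sum>t<11. t ^ k)"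
    by (simp add: sum_distrib_left)
  also have "of_nat (\<Sum>t<11. t ^ k) = (0 :: 'a)" using k(2) by (simp only: of_nat_eq_0_iff_11)
  finally show ?thesis by simp
qed

section \<open>Power moments of the trace over \<open>U\<close>\<close>

definition moment :: "'a \<Rightarrow> nat \<Rightarrow> 'a" where
  "moment a k = (\<Sum>u\<in>U. trace11 (2 * m) (a * u) ^ k)"

text \<open>The reflection keeps the trace and flips \<open>eta\<close>. Adding the reflected sum
  makes both signs of \<open>b\<close> occur at every \<open>u\<close>, which eliminates
  \<open>eta\<close>.\<close>

lemma symmetrised_moment:
  assumes a: "a \<noteq> 0" and eta: "eta (a ^ (q - 1)) \<noteq> 1" and zero: "(\<Sum>u\<in>U. val a b u ^ k) = 0"
  shows "(\<Sum>u\<in>U. (trace11 (2 * m) (a * u) + b) ^ k + (trace11 (2 * m) (a * u) - b) ^ k) = 0"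
proof -
  let ?T = "\<lambda>u. trace11 (2 * m) (a * u)"
  let ?r = "\<lambda>u. a ^ (q - 1) / u"
  have e: "eta (?r u) = - eta u" if "u \<in> U" for u
    using eta eta_cases[OF power_q1_U[OF a]] reflect_eta[OF that, of a] by auto
  have "(\<Sum>u\<in>U. val a b u ^ k) = (\<Sum>u\<in>U. (?T u - b * eta u) ^ k)"
    by (rule sum.reindex_bij_witness[of _ ?r ?r])
       (use a reflect_U[OF a] reflect_trace[OF a] e in \<open>auto simp: val_def U_nonzero\<close>)
  then have "(\<Sum>u\<in>U. (?T u + b * eta u) ^ k + (?T u - b * eta u) ^ k) = 0"
    using zero by (simp add: sum.distrib val_def)
  moreover have "(?T u + b * eta u) ^ k + (?T u - b * eta u) ^ k = (?T u + b) ^ k + (?T u - b) ^ k"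
    if "u \<in> U" for u
    using eta_cases[OF that] by (auto simp: add.commute)
  ultimately show ?thesis by simp
qed

lemma moment_0: "moment a 0 = 1"
  using sum_U_powi[of 0] by (simp add: moment_def)

text \<open>Odd powers of \<open>b\<close> cancel in the symmetrised binomials, and
  \<open>card U\<close> is 1 in the field. With \<open>moment_0\<close>, the relations say that the
  exponential generating function of the moments times cosh(bs) is 1 in the even degrees up to
  8.\<close>

lemma moment_relations:
  assumes cnt: "\<And>t. 0 < t \<Longrightarrow> t < 11 \<Longrightarrow> cnt a b 0 = cnt a b t + 1"
    and b: "b \<in> range (of_nat :: nat \<Rightarrow> 'a)"
    and a: "a \<noteq> 0" and eta: "eta (a ^ (q - 1)) \<noteq> 1"
  shows "moment a 2 + b ^ 2 = 0"
    "moment a 4 + 6 * b ^ 2 * moment a 2 + b ^ 4 = 0"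
    "moment a 6 + 15 * b ^ 2 * moment a 4 + 15 * b ^ 4 * moment a 2 + b ^ 6 = 0"
    "moment a 8 + 28 * b ^ 2 * moment a 6 + 70 * b ^ 4 * moment a 4 + 28 * b ^ 6 * moment a 2 + b ^ 8 = 0"
proof -
  let ?T = "\<lambda>u. trace11 (2 * m) (a * u)"
  have eq: "(\<Sum>u\<in>U. (?T u + b) ^ k + (?T u - b) ^ k) = 0" if "k > 0" "11 dvd (\<Sum>t<11::nat. t ^ k)" for k
    using symmetrised_moment[OF a eta val_moment_0[OF cnt b that]] by blast
  have halve: "x = 0" if "2 * x = 0" for x :: 'a using that two_neq_0 by (simp only: mult_eq_0_iff) simp
  have card: "of_nat (card U) = (1 :: 'a)" using moment_0[of a] by (simp add: moment_def)
  note collect = sum.distrib sum_distrib_left[symmetric] moment_def card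
  have "(\<Sum>u\<in>U. (?T u + b) ^ 2 + (?T u - b) ^ 2) = (\<Sum>u\<in>U. 2 * (?T u ^ 2 + b ^ 2))"
    by (rule sum.cong) (simp, algebra)
  then have "2 * (moment a 2 + b ^ 2) = 0"
    using eq[of 2] by (simp add: collect lessThan_nat_numeral lessThan_Suc)
  then show "moment a 2 + b ^ 2 = 0" by (rule halve)
  have "(\<Sum>u\<in>U. (?T u + b) ^ 4 + (?T u - b) ^ 4) =
      (\<Sum>u\<in>U. 2 * (?T u ^ 4 + 6 * b ^ 2 * ?T u ^ 2 + b ^ 4))"
    by (rule sum.cong) (simp, algebra)
  then have "2 * (moment a 4 + 6 * b ^ 2 * moment a 2 + b ^ 4) = 0"
    using eq[of 4] by (simp add: collect lessThan_nat_numeral lessThan_Suc)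
  then show "moment a 4 + 6 * b ^ 2 * moment a 2 + b ^ 4 = 0" by (rule halve)
  have "(\<Sum>u\<in>U. (?T u + b) ^ 6 + (?T u - b) ^ 6) =
      (\<Sum>u\<in>U. 2 * (?T u ^ 6 + 15 * b ^ 2 * ?T u ^ 4 + 15 * b ^ 4 * ?T u ^ 2 + b ^ 6))"
    by (rule sum.cong) (simp, algebra)
  then have "2 * (moment a 6 + 15 * b ^ 2 * moment a 4 + 15 * b ^ 4 * moment a 2 + b ^ 6) = 0"
    using eq[of 6] by (simp add: collect lessThan_nat_numeral lessThan_Suc)
  then show "moment a 6 + 15 * b ^ 2 * moment a 4 + 15 * b ^ 4 * moment a 2 + b ^ 6 = 0"
    by (rule halve)
  have "(\<Sum>u\<in>U. (?T u + b) ^ 8 + (?T u - b) ^ 8) = (\<Sum>u\<in>U. 2 * (?T u ^ 8 + 28 * b ^ 2 * ?T u ^ 6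
      + 70 * b ^ 4 * ?T u ^ 4 + 28 * b ^ 6 * ?T u ^ 2 + b ^ 8))"
    by (rule sum.cong) (simp, algebra)
  then have "2 * (moment a 8 + 28 * b ^ 2 * moment a 6 + 70 * b ^ 4 * moment a 4
      + 28 * b ^ 6 * moment a 2 + b ^ 8) = 0"
    using eq[of 8] by (simp add: collect lessThan_nat_numeral lessThan_Suc)
  then show "moment a 8 + 28 * b ^ 2 * moment a 6 + 70 * b ^ 4 * moment a 4
      + 28 * b ^ 6 * moment a 2 + b ^ 8 = 0" by (rule halve)
qed

end

section \<open>Moments modulo 11\<close>

text \<open>In characteristic 11 the coefficients of degree above 10 are 0, because 1 / 0 = 0.\<close>

definition dexp :: "'a::field \<Rightarrow> 'a fps" where
  "dexp x = Abs_fps (\<lambda>k. x ^ k / of_nat (fact k))"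

text \<open>The Bessel series I_0(2 X sqrt c).\<close>

definition bessel :: "'a::field \<Rightarrow> 'a fps" where
  "bessel c = Abs_fps (\<lambda>k. if even k then c ^ (k div 2) / of_nat (fact (k div 2)) ^ 2 else 0)"

text \<open>Needed because the exponential law for \<open>dexp\<close> holds only for low
  coefficients, not as an identity of series.\<close>

lemma fps_prod_nth_cong:
  fixes f g :: "'b \<Rightarrow> 'a::comm_semiring_1 fps"
  assumes "\<And>i k. i \<in> I \<Longrightarrow> k \<le> n \<Longrightarrow> f i $ k = g i $ k" "k \<le> n"
  shows "(\<Prod>i\<in>I. f i) $ k = (\<Prod>i\<in>I. g i) $ k"
  using assms
proof (induction I arbitrary: k rule: infinite_finite_induct)
  case (insert i I)
  then show ?case by (auto simp: fps_mult_nth intro!: sum.cong arg_cong2[where f = "(*)"])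
qed auto

text \<open>Four times the coefficient of X^8 in log f, for even f with constant coefficient 1.\<close>

definition log4 :: "'a::comm_ring_1 fps \<Rightarrow> 'a" where
  "log4 f = 4 * f $ 8 - 4 * f $ 2 * f $ 6 - 2 * (f $ 4) ^ 2 + 4 * (f $ 2) ^ 2 * f $ 4 - (f $ 2) ^ 4"

definition even_unit :: "'a::comm_ring_1 fps \<Rightarrow> bool" where
  "even_unit f \<longleftrightarrow> f $ 0 = 1 \<and> (\<forall>k. odd k \<longrightarrow> f $ k = 0)"

lemma even_unit_mult:
  assumes "even_unit f" "even_unit g"
  shows "even_unit (f * g)"
proof -
  have "(f * g) $ k = 0" if "odd k" for k
  proof -
    have "f $ i * g $ (k - i) = 0" if "i \<le> k" for i
      using assms \<open>odd k\<close> that by (cases "even i") (auto simp: even_unit_def)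
    then show ?thesis by (simp add: fps_mult_nth)
  qed
  then show ?thesis using assms by (simp add: even_unit_def)
qed

text \<open>Additivity of the logarithm, verified as a polynomial identity in the even coefficients
  up to degree 8.\<close>

lemma log4_mult:
  assumes "even_unit f" "even_unit g"
  shows "log4 (f * g) = log4 f + log4 g"
proof -
  have 1: "f $ 0 = 1" "f $ 1 = 0" "f $ 3 = 0" "f $ 5 = 0" "f $ 7 = 0"
    "g $ 0 = 1" "g $ 1 = 0" "g $ 3 = 0" "g $ 5 = 0" "g $ 7 = 0"
    using assms unfolding even_unit_def by simp_all
  have 2: "(f * g) $ 2 = f $ 2 + g $ 2"
    using 1 by (simp add: fps_mult_nth eval_nat_numeral algebra_simps)
  have 4: "(f * g) $ 4 = f $ 4 + f $ 2 * g $ 2 + g $ 4"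
    using 1 by (simp add: fps_mult_nth eval_nat_numeral algebra_simps)
  have 6: "(f * g) $ 6 = f $ 6 + f $ 4 * g $ 2 + f $ 2 * g $ 4 + g $ 6"
    using 1 by (simp add: fps_mult_nth eval_nat_numeral algebra_simps)
  have 8: "(f * g) $ 8 = f $ 8 + f $ 6 * g $ 2 + f $ 4 * g $ 4 + f $ 2 * g $ 6 + g $ 8"
    using 1 by (simp add: fps_mult_nth eval_nat_numeral algebra_simps)
  show ?thesis unfolding log4_def 2 4 6 8 by (simp add: algebra_simps power2_eq_square power4_eq_xxxx)
qed

lemma log4_prod:
  assumes "\<And>i. i \<in> I \<Longrightarrow> even_unit (f i)"
  shows "even_unit (\<Prod>i\<in>I. f i) \<and> log4 (\<Prod>i\<in>I. f i) = (\<Sum>i\<in>I. log4 (f i))"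
  using assms
proof (induction I rule: infinite_finite_induct)
  case (insert i I)
  then show ?case by (simp add: even_unit_mult log4_mult)
qed (simp_all add: even_unit_def log4_def)

context field_11_2m begin

section \<open>Truncated exponentials and their sums over \<open>U\<close>\<close>

lemma fact_neq_0: "k \<le> 10 \<Longrightarrow> (of_nat (fact k) :: 'a) \<noteq> 0"
  using of_nat_eq_0_iff_11[of "fact k"] by (simp add: prime_dvd_fact_iff)

text \<open>The binomial theorem; up to degree 10 all factorials are invertible modulo 11.\<close>

lemma dexp_mult:
  assumes "n \<le> 10"
  shows "(dexp x * dexp y) $ n = dexp (x + y :: 'a) $ n"
proof -
  have "(dexp x * dexp y) $ n = (\<Sum>i\<le>n. x ^ i / of_nat (fact i) * (y ^ (n - i) / of_nat (fact (n - i))))"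
    by (simp add: fps_mult_nth dexp_def atLeast0AtMost)
  also have "\<dots> = (\<Sum>i\<le>n. of_nat (n choose i) * x ^ i * y ^ (n - i) / of_nat (fact n))"
  proof (rule sum.cong)
    fix i assume "i \<in> {..n}"
    then have "i \<le> n" by simp
    have "(of_nat (fact n) :: 'a) = of_nat (fact i) * of_nat (fact (n - i)) * of_nat (n choose i)"
      unfolding of_nat_mult[symmetric] binomial_fact_lemma[OF \<open>i \<le> n\<close>] ..
    then show "x ^ i / of_nat (fact i) * (y ^ (n - i) / of_nat (fact (n - i))) =
        of_nat (n choose i) * x ^ i * y ^ (n - i) / of_nat (fact n)"
      using fact_neq_0[of n] fact_neq_0[of i] fact_neq_0[of "n - i"] assms \<open>i \<le> n\<close>
      by (simp add: field_simps del: of_nat_fact)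
  qed simp
  also have "\<dots> = dexp (x + y) $ n"
    by (simp add: dexp_def binomial_ring sum_divide_distrib)
  finally show ?thesis .
qed

lemma dexp_prod:
  fixes x :: "'b \<Rightarrow> 'a"
  assumes "finite I" "n \<le> 10"
  shows "(\<Prod>i\<in>I. dexp (x i)) $ n = dexp (\<Sum>i\<in>I. x i) $ n"
  using assms
proof (induction I arbitrary: n rule: finite_induct)
  case empty
  then show ?case by (cases n) (simp_all add: dexp_def)
next
  case (insert i I)
  have "(\<Prod>j\<in>insert i I. dexp (x j)) $ n = (dexp (x i) * dexp (\<Sum>j\<in>I. x j)) $ n"
    using insert by (simp add: fps_mult_nth)
  also have "\<dots> = dexp (\<Sum>j\<in>insert i I. x j) $ n"
    using insert by (simp add: dexp_mult)
  finally show ?case .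
qed

text \<open>Only the terms of total exponent 0 survive summation over U, since the exponents stay below
  q + 1. Peeling off the top factor j, an exponent divisible by 11^(j+1) can only be compensated if
  it is 0 and the two exponentials contribute equally, because |2d - l| < 11.\<close>

lemma exp_sum_constant_term:
  fixes A B :: "nat \<Rightarrow> 'a"
  assumes "j \<le> m" "n \<le> 8" "11 ^ j dvd h" "\<bar>h\<bar> + int n * 11 ^ (m - 1) \<le> 8 * 11 ^ (m - 1)"
  shows "(\<Sum>u\<in>U. u powi h * (\<Prod>i<j. dexp (A i * u powi (11 ^ i)) * dexp (B i * u powi (- (11 ^ i)))) $ n)
    = (if h = 0 then (\<Prod>i<j. bessel (A i * B i)) $ n else 0)"
  using assms
proof (induction j arbitrary: n h)
  case 0
  \<comment> \<open>The budget 8 * 11^(m-1) stays below \<open>q\<close>, the range in which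
    \<open>sum_U_powi\<close> detects exponent 0.\<close>
  have "int q = 11 * 11 ^ (m - 1)" unfolding q_def using m_pos by (cases m) simp_all
  moreover have "(0::int) \<le> int n * 11 ^ (m - 1)" by simp
  ultimately have "\<bar>h\<bar> \<le> int q" using 0(4) by linarith
  then show ?case using sum_U_powi[of h] by (cases n) auto
next
  case (Suc j)
  let ?G = "\<lambda>u. \<Prod>i<j. dexp (A i * u powi (11 ^ i)) * dexp (B i * u powi (- (11 ^ i)))"
  let ?W = "\<Prod>i<j. bessel (A i * B i)"
  let ?c = "\<lambda>l d. A j ^ d / of_nat (fact d) * (B j ^ (l - d) / of_nat (fact (l - d)))"
  let ?h = "\<lambda>l d. h + (2 * int d - int l) * 11 ^ j"
  \<comment> \<open>Degree \<open>d\<close> from the first exponential and \<open>l - d\<close> from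
    the second shift the exponent by (2d - l) 11^j.\<close>
  have last: "u powi h * (dexp (A j * u powi (11 ^ j)) * dexp (B j * u powi (- (11 ^ j)))) $ l =
      (\<Sum>d\<le>l. ?c l d * u powi ?h l d)" if u: "u \<in> U" for u l
  proof -
    have "u powi h * ((u powi (11 ^ j)) ^ d * (u powi (- (11 ^ j))) ^ (l - d)) = u powi ?h l d" if "d \<le> l" for d
    proof -
      have "?h l d = h + (11 ^ j * int d + (- (11 ^ j)) * int (l - d))"
        using that by (simp add: of_nat_diff algebra_simps)
      then show ?thesis using U_nonzero[OF u]
        by (simp only: power_int_add power_int_mult power_int_of_nat simp_thms)
    qed
    then show ?thesis
      by (auto simp: fps_mult_nth dexp_def atLeast0AtMost sum_distrib_left power_mult_distrib
        intro!: sum.cong)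
  qed
  \<comment> \<open>Spending degree \<open>l\<close> on factor \<open>j\<close> lowers the budget
    from \<open>n\<close> to \<open>k\<close>, which pays for a shift of at most l *
    11^(m-1).\<close>
  have h_bound: "\<bar>?h l d\<bar> + int k * 11 ^ (m - 1) \<le> 8 * 11 ^ (m - 1)" if "d \<le> l" "k + l = n" for k l d
  proof -
    have "\<bar>2 * int d - int l\<bar> \<le> int l" using that by simp
    moreover have "(11::int) ^ j \<le> 11 ^ (m - 1)" using Suc.prems(1) by (intro power_increasing) auto
    ultimately have "\<bar>(2 * int d - int l) * 11 ^ j\<bar> \<le> int l * 11 ^ (m - 1)"
      unfolding abs_mult by (intro mult_mono) auto
    moreover have "int n * 11 ^ (m - 1) = int k * 11 ^ (m - 1) + int l * 11 ^ (m - 1)"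
      using that by (simp add: algebra_simps flip: distrib_right of_nat_add)
    ultimately show ?thesis using Suc.prems(4) by linarith
  qed
  have h_zero: "?h l d = 0 \<longleftrightarrow> h = 0 \<and> 2 * d = l" if "d \<le> l" "l \<le> n" for l d
  proof
    assume eq: "?h l d = 0"
    have "11 ^ j * 11 dvd h" using Suc.prems(3) by (simp add: mult.commute)
    then have "11 ^ j * 11 dvd 11 ^ j * (2 * int d - int l)"
      using eq by (metis add_eq_0_iff dvd_minus_iff mult.commute)
    then have "11 dvd 2 * int d - int l" by simp
    moreover have "\<bar>2 * int d - int l\<bar> < 11" using that Suc.prems(2) by simp
    ultimately have "2 * int d - int l = 0" by (metis abs_numeral dvd_imp_le_int not_le)
    then show "h = 0 \<and> 2 * d = l" using eq by auto
  qed auto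
  have IH: "(\<Sum>u\<in>U. u powi ?h l d * ?G u $ k) = (if ?h l d = 0 then ?W $ k else 0)"
    if "d \<le> l" "k + l = n" for k l d
  proof (rule Suc.IH)
    have "11 ^ j dvd h" using Suc.prems(3) by (metis dvd_trans le_imp_power_dvd le_SucI order_refl)
    then show "11 ^ j dvd ?h l d" by simp
  qed (use that Suc.prems h_bound[OF that] in simp_all)
  \<comment> \<open>The surviving terms have d = l - d, giving (A j B j)^d / (d!)^2, a Bessel
    coefficient.\<close>
  have bessel: "(\<Sum>d\<le>l. if 2 * d = l then ?c l d else 0) = bessel (A j * B j) $ l" for l
  proof (cases "even l")
    case True
    then obtain e where l: "l = 2 * e" by blast
    have "(\<Sum>d\<le>l. if 2 * d = l then ?c l d else 0) = (\<Sum>d\<le>l. if d = e then ?c l d else 0)"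
      by (rule sum.cong) (auto simp: l)
    then show ?thesis
      by (simp add: l bessel_def power_mult_distrib power2_eq_square)
  qed (auto simp: bessel_def intro!: sum.neutral)
  have "(\<Sum>u\<in>U. u powi h * (\<Prod>i<Suc j. dexp (A i * u powi (11 ^ i)) * dexp (B i * u powi (- (11 ^ i)))) $ n)
      = (\<Sum>u\<in>U. \<Sum>k\<le>n. \<Sum>d\<le>n - k. ?c (n - k) d * (u powi ?h (n - k) d * ?G u $ k))"
  proof (rule sum.cong)
    fix u assume u: "u \<in> U"
    have "u powi h * (\<Prod>i<Suc j. dexp (A i * u powi (11 ^ i)) * dexp (B i * u powi (- (11 ^ i)))) $ n =
        (\<Sum>k\<le>n. ?G u $ k * (u powi h * (dexp (A j * u powi (11 ^ j)) * dexp (B j * u powi (- (11 ^ j)))) $ (n - k)))"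
      unfolding prod.lessThan_Suc fps_mult_nth[of "prod _ _"] atLeast0AtMost sum_distrib_left
      by (simp only: mult.left_commute)
    also have "\<dots> = (\<Sum>k\<le>n. \<Sum>d\<le>n - k. ?c (n - k) d * (u powi ?h (n - k) d * ?G u $ k))"
      unfolding last[OF u] sum_distrib_left by (simp only: mult.left_commute mult.commute mult.assoc)
    finally show "u powi h * (\<Prod>i<Suc j. dexp (A i * u powi (11 ^ i)) * dexp (B i * u powi (- (11 ^ i)))) $ n = \<dots>" .
  qed simp
  also have "\<dots> = (\<Sum>k\<le>n. \<Sum>d\<le>n - k. ?c (n - k) d * (\<Sum>u\<in>U. u powi ?h (n - k) d * ?G u $ k))"
    unfolding sum_distrib_left by (subst sum.swap) (intro sum.cong refl, subst sum.swap, rule refl)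
  also have "\<dots> = (\<Sum>k\<le>n. \<Sum>d\<le>n - k. if h = 0 then ?W $ k * (if 2 * d = n - k then ?c (n - k) d else 0) else 0)"
  proof (intro sum.cong refl)
    fix k d assume "k \<in> {..n}" "d \<in> {..n - k}"
    then have k: "d \<le> n - k" "k + (n - k) = n" "n - k \<le> n" by simp_all
    show "?c (n - k) d * (\<Sum>u\<in>U. u powi ?h (n - k) d * ?G u $ k) =
        (if h = 0 then ?W $ k * (if 2 * d = n - k then ?c (n - k) d else 0) else 0)"
      unfolding IH[OF k(1,2)] h_zero[OF k(1,3)] by simp
  qed
  also have "\<dots> = (if h = 0 then \<Sum>k\<le>n. ?W $ k * bessel (A j * B j) $ (n - k) else 0)"
    by (simp add: sum_distrib_left[symmetric] bessel)
  also have "\<dots> = (if h = 0 then (\<Prod>i<Suc j. bessel (A i * B i)) $ n else 0)"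
    by (simp add: fps_mult_nth atLeast0AtMost)
  finally show ?case .
qed

text \<open>The trace splits into \<open>m\<close> pairs of conjugates. Its exponential becomes a
  product of exponentials in u^(11^i) and u^(-11^i), and summing over \<open>U\<close> extracts the
  constant term.\<close>

lemma moment_eq_bessel:
  assumes "n \<le> 8"
  shows "moment a n = of_nat (fact n) * (\<Prod>i<m. bessel (a ^ 11 ^ i * (a ^ q) ^ 11 ^ i)) $ n"
proof -
  let ?A = "\<lambda>i. a ^ 11 ^ i" and ?B = "\<lambda>i. (a ^ q) ^ 11 ^ i"
  have T: "trace11 (2 * m) (a * u) = (\<Sum>i<m. ?A i * u powi (11 ^ i) + ?B i * u powi (- (11 ^ i)))"
    if u: "u \<in> U" for u
  proof -
    have pi: "u powi (11 ^ i) = u ^ 11 ^ i" for i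
      by (metis power_int_of_nat of_nat_numeral of_nat_power)
    have split: "(\<Sum>k<m + j. f k) = (\<Sum>i<m. f i) + (\<Sum>i<j. f (m + i))" for f :: "nat \<Rightarrow> 'a" and j
      by (induction j) (simp_all add: add.assoc)
    \<comment> \<open>The upper half of the conjugates involves u^q, the inverse of
      \<open>u\<close>.\<close>
    have "trace11 (2 * m) (a * u) = (\<Sum>i<m. (a * u) ^ 11 ^ i) + (\<Sum>i<m. (a * u) ^ 11 ^ (m + i))"
      unfolding trace11_def mult_2 by (rule split)
    moreover have "(a * u) ^ 11 ^ (m + i) = ?B i * u powi (- (11 ^ i))" for i
    proof -
      have "(a * u) ^ 11 ^ (m + i) = ((a * u) ^ q) ^ 11 ^ i" by (simp add: q_def power_add power_mult)
      also have "\<dots> = (a ^ q) ^ 11 ^ i * (inverse u) ^ 11 ^ i"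
        using U_power_q[OF u] by (simp add: power_mult_distrib)
      finally show ?thesis by (simp add: power_int_minus pi power_inverse)
    qed
    ultimately show ?thesis by (simp add: sum.distrib pi power_mult_distrib)
  qed
  have "(\<Prod>i<m. dexp (?A i * u powi (11 ^ i)) * dexp (?B i * u powi (- (11 ^ i)))) $ n
      = trace11 (2 * m) (a * u) ^ n / of_nat (fact n)" if "u \<in> U" for u
  proof -
    have "(\<Prod>i<m. dexp (?A i * u powi (11 ^ i)) * dexp (?B i * u powi (- (11 ^ i)))) $ n =
        (\<Prod>i<m. dexp (?A i * u powi (11 ^ i) + ?B i * u powi (- (11 ^ i)))) $ n"
      by (rule fps_prod_nth_cong[where n = n]) (use assms in \<open>simp_all add: dexp_mult\<close>)
    also have "\<dots> = dexp (trace11 (2 * m) (a * u)) $ n"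
      unfolding T[OF that] using assms by (intro dexp_prod) auto
    finally show ?thesis by (simp add: dexp_def)
  qed
  then have "moment a n / of_nat (fact n) =
      (\<Sum>u\<in>U. u powi 0 * (\<Prod>i<m. dexp (?A i * u powi (11 ^ i)) * dexp (?B i * u powi (- (11 ^ i)))) $ n)"
    by (simp add: moment_def sum_divide_distrib)
  also have "\<dots> = (\<Prod>i<m. bessel (?A i * ?B i)) $ n"
    using assms exp_sum_constant_term[of m n 0 ?A ?B] by simp
  finally show ?thesis using fact_neq_0[of n] assms by (simp add: field_simps del: of_nat_fact)
qed

text \<open>The coefficient of x^4 in log I_0(2 sqrt x) is -11/192.\<close>

lemma log4_bessel: "log4 (bessel c :: 'a fps) = 0"
proof -
  have nz: "(4 :: 'a) \<noteq> 0" "(36 :: 'a) \<noteq> 0" "(576 :: 'a) \<noteq> 0"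
    using of_nat_eq_0_iff_11[of 4] of_nat_eq_0_iff_11[of 36] of_nat_eq_0_iff_11[of 576] by simp_all
  \<comment> \<open>These are 4*3, 36*4 and 576*3: they invert the squares of 2!, 3! and 4! modulo
    11.\<close>
  have "(12 :: 'a) = 1" "(144 :: 'a) = 1" "(1728 :: 'a) = 1"
    using of_nat_eq_iff_mod[of 12 1] of_nat_eq_iff_mod[of 144 1] of_nat_eq_iff_mod[of 1728 1] by simp_all
  then have inv: "x / 4 = 3 * x" "x / 36 = 4 * x" "x / 576 = 3 * x" for x :: 'a
    using nz by (simp_all add: divide_eq_eq mult.commute mult.left_commute)
  have coeffs: "bessel c $ 2 = c" "bessel c $ 4 = 3 * c ^ 2" "bessel c $ 6 = 4 * c ^ 3" "bessel c $ 8 = 3 * c ^ 4"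
    by (simp_all add: bessel_def fact_numeral inv)
  have "log4 (bessel c) = 11 * - (c ^ 4)" unfolding log4_def coeffs by algebra
  then show ?thesis by (simp add: eleven_eq_0)
qed

lemma even_unit_bessel: "even_unit (bessel c)"
  by (simp add: even_unit_def bessel_def)

text \<open>\<open>log4\<close> of the Bessel product vanishes. The integer coefficients are chosen
  so that substituting k! times the series coefficient for \<open>moment a k\<close> reproduces
  \<open>log4\<close> modulo 11; \<open>regroup\<close> splits off the multiple of 11.\<close>

lemma moment_log_relation:
  "36 * moment a 8 - 216 * moment a 2 * moment a 6 - 72 * moment a 4 ^ 2
    + 864 * moment a 2 ^ 2 * moment a 4 - 1296 * moment a 2 ^ 4 = 0"
proof -
  let ?W = "\<Prod>i<m. bessel (a ^ 11 ^ i * (a ^ q) ^ 11 ^ i)"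
  have "log4 ?W = 0" using log4_prod[of "{..<m}" "\<lambda>i. bessel (a ^ 11 ^ i * (a ^ q) ^ 11 ^ i)"]
    by (simp add: even_unit_bessel log4_bessel)
  then have L: "4 * ?W $ 8 - 4 * ?W $ 2 * ?W $ 6 - 2 * (?W $ 4) ^ 2 + 4 * (?W $ 2) ^ 2 * ?W $ 4 - (?W $ 2) ^ 4 = 0"
    by (simp only: log4_def)
  have M: "moment a 2 = 2 * ?W $ 2" "moment a 4 = 24 * ?W $ 4" "moment a 6 = 720 * ?W $ 6" "moment a 8 = 40320 * ?W $ 8"
    by (simp_all add: moment_eq_bessel fact_numeral)
  have regroup: "36 * (40320 * w8) - 216 * (2 * w2) * (720 * w6) - 72 * (24 * w4) ^ 2 + 864 * (2 * w2) ^ 2 * (24 * w4)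
      - 1296 * (2 * w2) ^ 4 = (4 * w8 - 4 * w2 * w6 - 2 * w4 ^ 2 + 4 * w2 ^ 2 * w4 - w2 ^ 4)
      + 11 * (131956 * w8 - 28276 * w2 * w6 - 3770 * w4 ^ 2 + 7540 * w2 ^ 2 * w4 - 1885 * w2 ^ 4)"
    for w2 w4 w6 w8 :: 'a
    by (simp add: power_mult_distrib algebra_simps)
  show ?thesis unfolding M regroup L eleven_eq_0 by (simp only: mult_zero_left add_0_right)
qed

lemma not_regular_bent:
  assumes b: "b \<in> range (of_nat :: nat \<Rightarrow> 'a)" and t: "gcd t (11 ^ m + 1) = 1"
  shows "\<not> regular_bent11 (2 * m) (f_abt m (2 * m) a b t)"
proof
  assume "regular_bent11 (2 * m) (f_abt m (2 * m) a b t)"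
  then have cnt: "\<And>s. 0 < s \<Longrightarrow> s < 11 \<Longrightarrow> cnt a b 0 = cnt a b s + 1"
    using regular_bent_cnt[OF _ b t] by blast
  have a: "a \<noteq> 0" using no_zero_a cnt by blast
  have "b \<noteq> 0" and eta: "eta (a ^ (q - 1)) \<noteq> 1" using no_symmetric_val[OF cnt a] by blast+
  have M: "moment a 2 + b ^ 2 = 0"
    "moment a 4 + 6 * b ^ 2 * moment a 2 + b ^ 4 = 0"
    "moment a 6 + 15 * b ^ 2 * moment a 4 + 15 * b ^ 4 * moment a 2 + b ^ 6 = 0"
    "moment a 8 + 28 * b ^ 2 * moment a 6 + 70 * b ^ 4 * moment a 4 + 28 * b ^ 6 * moment a 2 + b ^ 8 = 0"
    using moment_relations[of a b] cnt b a eta by blast+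
  \<comment> \<open>The factors -1, 5, -61, 1385 are the Euler numbers, the Taylor coefficients of
    1/cosh times factorials.\<close>
  have M2: "moment a 2 = - (b ^ 2)" using M(1) by (simp add: eq_neg_iff_add_eq_0)
  have M4: "moment a 4 = 5 * b ^ 4" using M(2) unfolding M2 by algebra
  have M6: "moment a 6 = - 61 * b ^ 6" using M(3) unfolding M2 M4 by algebra
  have M8: "moment a 8 = 1385 * b ^ 8" using M(4) unfolding M2 M4 M6 by algebra
  have "37908 * b ^ 8 = 0" using moment_log_relation[of a] unfolding M2 M4 M6 M8 by algebra
  \<comment> \<open>The residue 2 is four times 17/2520 modulo 11, the nonvanishing logarithmic
    coefficient of 1/cosh.\<close>
  moreover have "37908 * b ^ 8 = 2 * b ^ 8 + 11 * (3446 * b ^ 8)" by simp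
  ultimately have "2 * b ^ 8 = 0" unfolding eleven_eq_0 by (simp only: mult_zero_left add_0_right)
  then show False using \<open>b \<noteq> 0\<close> two_neq_0 by simp
qed

end

theorem theorem11:
  fixes a b :: "'a::{field,finite}" and m n :: nat and t :: int
  assumes "even m" and "m > 0" and "n = 2 * m"
    and "card (UNIV :: 'a set) = 11 ^ n"
    and "b \<in> range (of_nat :: nat \<Rightarrow> 'a)"
    and "gcd t (11 ^ m + 1) = 1"
  shows "\<not> regular_bent11 n (f_abt m n a b t)"
proof -
  interpret field_11_2m m "TYPE('a)"
    using assms by unfold_locales simp_all
  show ?thesis using not_regular_bent assms by simp
qed

end
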